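(* Let $R$ be a commutative ring with identity $1\neq 0$ and let $M$ be a unital $R$-module. For any prime submodule $P$ of $M$, the stalk $(\mathcal{O}_{\mathrm{Spec}(M)})_P$ at $P$ of the sheaf of $R$-modules $\mathcal{O}_{\mathrm{Spec}(M)}$ on $\mathrm{Spec}(M)$ is isomorphic (as an $R$-module) to the localization $M_{\mathcal{P}}$, where $\mathcal{P}=(P:M)$.
   Context: All rings are commutative with $1\neq 0$ and modules are unital. For a submodule $N$ of $M$, $(N:M)=\{r\in R: rM\subseteq N\}$. A proper submodule $P$ of $M$ is prime if for $a\in R$, $m\in M$, $am\in P$ implies $m\in P$ or $aM\subseteq P$; then $(P:M)$ is a prime ideal of $R$. $\mathrm{Spec}(M)$ is the set of all prime submodules of $M$. For a submodule $N\le M$, $V(N)=\{P\in\mathrm{Spec}(M):(N:M)\subseteq(P:M)\}$; the sets $V(N)$ are the closed sets of the Zariski topology on $\mathrm{Spec}(M)$. For $P\in\mathrm{Spec}(M)$, $M_{\mathcal{P}}$ denotes the localization of $M$ at the prime ideal $\mathcal{P}=(P:M)$. The sheaf $\mathcal{O}_{\mathrm{Spec}(M)}$ is defined as follows: for $U\subseteq \mathrm{Spec}(M)$ open, $\mathcal{O}_{\mathrm{Spec}(M)}(U)$ is the set of functions $s:U\to\coprod_{P\in U}M_{(P:M)}$ with $s(P)\in M_{(P:M)}$ for all $P\in U$, such that for every $P\in U$ there are an open neighborhood $W\subseteq U$ of $P$ and elements $m\in M$, $g\in R$ such that for every $Q\in W$ one has $g\notin (Q:M)$ and $s(Q)=\frac{m}{g}$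 in $M_{(Q:M)}$. Addition and the $R$-action are pointwise, and restriction maps are restrictions of functions; this is a sheaf of $R$-modules. *)

theory Defs
  imports "HOL-Analysis.Abstract_Topology" "HOL-Algebra.Module"
begin

section \<open>Prime submodules and the Zariski topology\<close>

definition colon :: "('a, 'r) ring_scheme \<Rightarrow> ('a, 'b, 'm) module_scheme \<Rightarrow> 'b set \<Rightarrow> 'a set"
  where "colon R M N = {r \<in> carrier R. (\<lambda>x. r \<odot>\<^bsub>M\<^esub> x) ` carrier M \<subseteq> N}"

definition prime_submodule ::
    "('a, 'r) ring_scheme \<Rightarrow> ('a, 'b, 'm) module_scheme \<Rightarrow> 'b set \<Rightarrow> bool"
  where "prime_submodule R M P \<longleftrightarrow>
    submodule P R M \<and> P \<noteq> carrier M \<and>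
    (\<forall>a \<in> carrier R. \<forall>m \<in> carrier M.
      a \<odot>\<^bsub>M\<^esub> m \<in> P \<longrightarrow> m \<in> P \<or> (\<lambda>x. a \<odot>\<^bsub>M\<^esub> x) ` carrier M \<subseteq> P)"

definition mSpec :: "('a, 'r) ring_scheme \<Rightarrow> ('a, 'b, 'm) module_scheme \<Rightarrow> 'b set set"
  where "mSpec R M = {P. prime_submodule R M P}"

definition zariski_V ::
    "('a, 'r) ring_scheme \<Rightarrow> ('a, 'b, 'm) module_scheme \<Rightarrow> 'b set \<Rightarrow> 'b set set"
  where "zariski_V R M N = {P \<in> mSpec R M. colon R M N \<subseteq> colon R M P}"

definition zariski_topology ::
    "('a, 'r) ring_scheme \<Rightarrow> ('a, 'b, 'm) module_scheme \<Rightarrow> 'b set topology"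
  where "zariski_topology R M =
    topology (\<lambda>U. \<exists>N. submodule N R M \<and> U = mSpec R M - zariski_V R M N)"

lemma (in Module.module) submodule_Inter:
  assumes "\<And>N. N \<in> \<N> \<Longrightarrow> submodule N R M" "\<N> \<noteq> {}"
  shows "submodule (\<Inter>\<N>) R M"
proof (rule submoduleI)
  show "\<Inter>\<N> \<subseteq> carrier M"
    using assms submoduleE(1) by blast
  show "\<zero>\<^bsub>M\<^esub> \<in> \<Inter>\<N>"
    using assms(1) subgroup.one_closed[OF submodule.axioms(1)] by fastforce
next
  fix a assume "a \<in> \<Inter>\<N>" then show "\<ominus>\<^bsub>M\<^esub> a \<in> \<Inter>\<N>"
    using assms(1) submoduleE(3) by simp
next
  fix a b assume "a \<in> \<Inter>\<N>" "b \<in> \<Inter>\<N>" then show "a \<oplus>\<^bsub>M\<^esub> b \<in> \<Inter>\<N>"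
    using assms(1) submoduleE(5) by simp
next
  fix a x assume "a \<in> carrier R" "x \<in> \<Inter>\<N>" then show "a \<odot>\<^bsub>M\<^esub> x \<in> \<Inter>\<N>"
    using assms(1) submoduleE(4) by simp
qed

lemma (in Module.module) colon_Int: "colon R M (N \<inter> L) = colon R M N \<inter> colon R M L"
  by (auto simp: colon_def)

lemma (in Module.module) colon_mult:
  assumes "submodule N R M" "a \<in> colon R M N" "b \<in> carrier R"
  shows "a \<otimes>\<^bsub>R\<^esub> b \<in> colon R M N"
  using assms by (auto simp: colon_def smult_assoc1)

lemma (in Module.module) colon_prime:
  assumes "prime_submodule R M P" "a \<in> carrier R" "b \<in> carrier R" "a \<otimes>\<^bsub>R\<^esub> b \<in> colon R M P"
  shows "a \<in> colon R M P \<or> b \<in> colon R M P"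
proof (rule ccontr)
  assume *: "\<not> ?thesis"
  then obtain x where x: "x \<in> carrier M" "b \<odot>\<^bsub>M\<^esub> x \<notin> P"
    using assms by (auto simp: colon_def)
  have "a \<odot>\<^bsub>M\<^esub> (b \<odot>\<^bsub>M\<^esub> x) \<in> P"
    using assms x by (auto simp: colon_def smult_assoc1)
  then show False
    using assms(1-3) x * by (auto simp: colon_def prime_submodule_def)
qed

lemma (in Module.module) zariski_V_Int:
  assumes "submodule N R M" "submodule L R M"
  shows "zariski_V R M (N \<inter> L) = zariski_V R M N \<union> zariski_V R M L"
proof
  show "zariski_V R M (N \<inter> L) \<subseteq> zariski_V R M N \<union> zariski_V R M L"
  proof (rule ccontr)
    assume "\<not> ?thesis"
    then obtain P a b where P: "prime_submodule R M P" "colon R M N \<inter> colon R M L \<subseteq> colon R M P"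
      and a: "a \<in> colon R M N" "a \<notin> colon R M P" and b: "b \<in> colon R M L" "b \<notin> colon R M P"
      by (auto simp: zariski_V_def mSpec_def colon_Int)
    have ab: "a \<in> carrier R" "b \<in> carrier R"
      using a b by (auto simp: colon_def)
    have "a \<otimes>\<^bsub>R\<^esub> b \<in> colon R M N" "b \<otimes>\<^bsub>R\<^esub> a \<in> colon R M L"
      using colon_mult assms a b ab by auto
    then have "a \<otimes>\<^bsub>R\<^esub> b \<in> colon R M P"
      using P ab by (auto simp: R.m_comm)
    then show False
      using colon_prime P a b ab by blast
  qed
qed (auto simp: zariski_V_def colon_Int)

lemma (in Module.module) zariski_V_Inter:
  assumes "\<And>N. N \<in> \<N> \<Longrightarrow> submodule N R M"
  shows "\<exists>L. submodule L R M \<and> zariski_V R M L = mSpec R M \<inter> (\<Inter>N\<in>\<N>. zariski_V R M N)"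
proof (intro exI conjI)
  define G where "G = {r \<odot>\<^bsub>M\<^esub> x | r x N. N \<in> \<N> \<and> r \<in> colon R M N \<and> x \<in> carrier M}"
  define L where "L = \<Inter>{K. submodule K R M \<and> G \<subseteq> K}"
  have "G \<subseteq> carrier M"
    by (auto simp: G_def colon_def)
  then show "submodule L R M"
    unfolding L_def using carrier_is_submodule by (intro submodule_Inter) auto
  have "colon R M N \<subseteq> colon R M L" if "N \<in> \<N>" for N
  proof
    fix r assume r: "r \<in> colon R M N"
    then have "(\<lambda>x. r \<odot>\<^bsub>M\<^esub> x) ` carrier M \<subseteq> G"
      using that by (auto simp: G_def)
    also have "G \<subseteq> L"
      by (auto simp: L_def)
    finally show "r \<in> colon R M L"
      using r by (simp add: colon_def)
  qed
  moreover have "colon R M L \<subseteq> colon R M P"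
    if "P \<in> mSpec R M" "\<And>N. N \<in> \<N> \<Longrightarrow> colon R M N \<subseteq> colon R M P" for P
  proof -
    have "G \<subseteq> P"
    proof
      fix y assume "y \<in> G"
      then obtain r x N where "N \<in> \<N>" "r \<in> colon R M N" "x \<in> carrier M" "y = r \<odot>\<^bsub>M\<^esub> x"
        by (auto simp: G_def)
      then show "y \<in> P"
        using that(2)[of N] by (auto simp: colon_def)
    qed
    then have "L \<subseteq> P"
      using that(1) by (auto simp: L_def mSpec_def prime_submodule_def)
    then show ?thesis
      by (auto simp: colon_def)
  qed
  ultimately have "colon R M L \<subseteq> colon R M P \<longleftrightarrow> (\<forall>N\<in>\<N>. colon R M N \<subseteq> colon R M P)"
    if "P \<in> mSpec R M" for P
    using that by (meson subset_trans)
  then show "zariski_V R M L = mSpec R M \<inter> (\<Inter>N\<in>\<N>. zariski_V R M N)"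
    unfolding zariski_V_def by auto
qed

lemma (in Module.module) openin_zariski:
  "openin (zariski_topology R M) U \<longleftrightarrow>
    (\<exists>N. submodule N R M \<and> U = mSpec R M - zariski_V R M N)"
proof -
  let ?L = "\<lambda>U. \<exists>N. submodule N R M \<and> U = mSpec R M - zariski_V R M N"
  have "istopology ?L"
    unfolding istopology_def
  proof (intro conjI allI impI)
    fix S T assume "?L S" "?L T"
    then obtain N L where *: "submodule N R M" "submodule L R M"
      "S = mSpec R M - zariski_V R M N" "T = mSpec R M - zariski_V R M L"
      by blast
    have "submodule (N \<inter> L) R M"
      using submodule_Inter[of "{N, L}"] * by auto
    moreover have "S \<inter> T = mSpec R M - zariski_V R M (N \<inter> L)"
      using * by (auto simp: zariski_V_Int)
    ultimately show "?L (S \<inter> T)"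
      by blast
  next
    fix \<K> assume \<K>: "\<forall>K\<in>\<K>. ?L K"
    define \<N> where "\<N> = {N. submodule N R M \<and> mSpec R M - zariski_V R M N \<in> \<K>}"
    obtain L where "submodule L R M"
      "zariski_V R M L = mSpec R M \<inter> (\<Inter>N\<in>\<N>. zariski_V R M N)"
      using zariski_V_Inter[of \<N>] unfolding \<N>_def by blast
    moreover have "\<Union>\<K> = (\<Union>N\<in>\<N>. mSpec R M - zariski_V R M N)"
    proof -
      have "\<K> = (\<lambda>N. mSpec R M - zariski_V R M N) ` \<N>"
      proof (intro equalityI subsetI)
        fix K assume "K \<in> \<K>"
        then obtain N where "submodule N R M" "K = mSpec R M - zariski_V R M N"
          using \<K> by blast
        with \<open>K \<in> \<K>\<close> show "K \<in> (\<lambda>N. mSpec R M - zariski_V R M N) ` \<N>"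
          unfolding \<N>_def by simp
      qed (auto simp: \<N>_def)
      then show ?thesis
        by simp
    qed
    ultimately have "\<Union>\<K> = mSpec R M - zariski_V R M L"
      by auto
    with \<open>submodule L R M\<close> show "?L (\<Union>\<K>)"
      by blast
  qed
  then show ?thesis
    by (simp add: zariski_topology_def)
qed

lemma (in Module.module) topspace_zariski: "topspace (zariski_topology R M) = mSpec R M"
proof -
  have "zariski_V R M (carrier M) = {}"
  proof -
    have False if "P \<in> mSpec R M" "colon R M (carrier M) \<subseteq> colon R M P" for P
    proof -
      have "\<one>\<^bsub>R\<^esub> \<in> colon R M (carrier M)"
        by (auto simp: colon_def)
      then have "\<one>\<^bsub>R\<^esub> \<in> colon R M P"
        using that(2) by blast
      then have "\<one>\<^bsub>R\<^esub> \<odot>\<^bsub>M\<^esub> x \<in> P" if "x \<in> carrier M" for x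
        using that by (auto simp: colon_def)
      then have "carrier M \<subseteq> P"
        by auto
      then show False
        using that(1) submoduleE(1) by (auto simp: mSpec_def prime_submodule_def)
    qed
    then show ?thesis
      by (auto simp: zariski_V_def)
  qed
  then have "openin (zariski_topology R M) (mSpec R M)"
    unfolding openin_zariski using carrier_is_submodule by (intro exI[of _ "carrier M"]) auto
  moreover have "topspace (zariski_topology R M) \<subseteq> mSpec R M"
    unfolding topspace_def openin_zariski by auto
  ultimately show ?thesis
    by (simp add: openin_subset subset_antisym)
qed

lemma (in Module.module) closedin_zariski:
  "closedin (zariski_topology R M) C \<longleftrightarrow> (\<exists>N. submodule N R M \<and> C = zariski_V R M N)"
proof -
  have "zariski_V R M N \<subseteq> mSpec R M" for N
    by (auto simp: zariski_V_def)
  then show ?thesis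
    unfolding closedin_def topspace_zariski openin_zariski
    by (metis Diff_Diff_Int inf.absorb_iff2)
qed


section \<open>Localization of modules\<close>

text \<open>
  All modules constructed below are records that extend a ring record; the ring fields
  \<open>mult\<close> and \<open>one\<close> play no role for modules and are left \<open>undefined\<close>.
\<close>

definition frac_rel ::
    "('a, 'r) ring_scheme \<Rightarrow> ('a, 'b, 'm) module_scheme \<Rightarrow> 'a set \<Rightarrow> (('b \<times> 'a) \<times> ('b \<times> 'a)) set"
  where "frac_rel R M S =
    {((m, g), (n, h)). m \<in> carrier M \<and> g \<in> S \<and> n \<in> carrier M \<and> h \<in> S \<and>
      (\<exists>u \<in> S. u \<odot>\<^bsub>M\<^esub> (h \<odot>\<^bsub>M\<^esub> m \<ominus>\<^bsub>M\<^esub> g \<odot>\<^bsub>M\<^esub> n) = \<zero>\<^bsub>M\<^esub>)}"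

definition frac ::
    "('a, 'r) ring_scheme \<Rightarrow> ('a, 'b, 'm) module_scheme \<Rightarrow> 'a set \<Rightarrow> 'b \<Rightarrow> 'a \<Rightarrow> ('b \<times> 'a) set"
  where "frac R M S m g = frac_rel R M S `` {(m, g)}"

definition localization ::
    "('a, 'r) ring_scheme \<Rightarrow> ('a, 'b, 'm) module_scheme \<Rightarrow> 'a set \<Rightarrow> ('a, ('b \<times> 'a) set) module"
  where "localization R M S =
    \<lparr>carrier = (carrier M \<times> S) // frac_rel R M S,
     mult = undefined,
     one = undefined,
     zero = frac R M S \<zero>\<^bsub>M\<^esub> \<one>\<^bsub>R\<^esub>,
     add = (\<lambda>X Y. \<Union>(m, g) \<in> X. \<Union>(n, h) \<in> Y.
              frac R M S (h \<odot>\<^bsub>M\<^esub> m \<oplus>\<^bsub>M\<^esub> g \<odot>\<^bsub>M\<^esub> n) (g \<otimes>\<^bsub>R\<^esub> h)),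
     smult = (\<lambda>a X. \<Union>(m, g) \<in> X. frac R M S (a \<odot>\<^bsub>M\<^esub> m) g)\<rparr>"

definition localization_at ::
    "('a, 'r) ring_scheme \<Rightarrow> ('a, 'b, 'm) module_scheme \<Rightarrow> 'a set \<Rightarrow> ('a, ('b \<times> 'a) set) module"
  where "localization_at R M \<pp> = localization R M (carrier R - \<pp>)"


section \<open>The structure sheaf\<close>

text \<open>
  A section over \<open>U\<close> is a dependent function on \<open>U\<close>; as usual for \<open>Pi\<^sub>E\<close>, it is normalised to
  be \<open>undefined\<close> outside \<open>U\<close>, so that equality of sections is equality on \<open>U\<close>.
\<close>

definition sections ::
    "('a, 'r) ring_scheme \<Rightarrow> ('a, 'b, 'm) module_scheme \<Rightarrow> 'b set set \<Rightarrow>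
      ('b set \<Rightarrow> ('b \<times> 'a) set) set"
  where "sections R M U =
    {s \<in> (\<Pi>\<^sub>E P\<in>U. carrier (localization_at R M (colon R M P))).
      \<forall>P\<in>U. \<exists>W m g. openin (zariski_topology R M) W \<and> P \<in> W \<and> W \<subseteq> U \<and>
        m \<in> carrier M \<and> g \<in> carrier R \<and>
        (\<forall>Q\<in>W. g \<notin> colon R M Q \<and> s Q = frac R M (carrier R - colon R M Q) m g)}"

definition structure_sheaf ::
    "('a, 'r) ring_scheme \<Rightarrow> ('a, 'b, 'm) module_scheme \<Rightarrow> 'b set set \<Rightarrow>
      ('a, 'b set \<Rightarrow> ('b \<times> 'a) set) module"
  where "structure_sheaf R M U =
    \<lparr>carrier = sections R M U,
     mult = undefined,
     one = undefined,
     zero = (\<lambda>P\<in>U. \<zero>\<^bsub>localization_at R M (colon R M P)\<^esub>),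
     add = (\<lambda>s t. \<lambda>P\<in>U. s P \<oplus>\<^bsub>localization_at R M (colon R M P)\<^esub> t P),
     smult = (\<lambda>a s. \<lambda>P\<in>U. a \<odot>\<^bsub>localization_at R M (colon R M P)\<^esub> s P)\<rparr>"

definition section_restrict :: "'p set \<Rightarrow> 'p set \<Rightarrow> ('p \<Rightarrow> 'c) \<Rightarrow> ('p \<Rightarrow> 'c)"
  where "section_restrict U V s = restrict s V"


section \<open>Stalks of presheaves of modules\<close>

text \<open>
  A presheaf of modules on \<open>X\<close> is given by its modules of sections \<open>F U\<close> for open \<open>U\<close> and its
  restriction maps \<open>\<rho> U V\<close> from \<open>F U\<close> to \<open>F V\<close> for open \<open>V \<subseteq> U\<close>. Its stalk at \<open>p\<close> is the direct
  limit of the \<open>F U\<close> over the open neighbourhoods \<open>U\<close> of \<open>p\<close>, i.e. the module of germs.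
\<close>

definition local_sections ::
    "'p topology \<Rightarrow> ('p set \<Rightarrow> ('a, 'c) module) \<Rightarrow> 'p \<Rightarrow> ('p set \<times> 'c) set"
  where "local_sections X F p = (SIGMA U:{U. openin X U \<and> p \<in> U}. carrier (F U))"

definition germ_rel ::
    "'p topology \<Rightarrow> ('p set \<Rightarrow> ('a, 'c) module) \<Rightarrow> ('p set \<Rightarrow> 'p set \<Rightarrow> 'c \<Rightarrow> 'c) \<Rightarrow> 'p \<Rightarrow>
      (('p set \<times> 'c) \<times> ('p set \<times> 'c)) set"
  where "germ_rel X F \<rho> p =
    {((U, s), (V, t)). (U, s) \<in> local_sections X F p \<and> (V, t) \<in> local_sections X F p \<and>
      (\<exists>W. openin X W \<and> p \<in> W \<and> W \<subseteq> U \<inter> V \<and> \<rho> U W s = \<rho> V W t)}"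

definition germ ::
    "'p topology \<Rightarrow> ('p set \<Rightarrow> ('a, 'c) module) \<Rightarrow> ('p set \<Rightarrow> 'p set \<Rightarrow> 'c \<Rightarrow> 'c) \<Rightarrow> 'p \<Rightarrow>
      'p set \<Rightarrow> 'c \<Rightarrow> ('p set \<times> 'c) set"
  where "germ X F \<rho> p U s = germ_rel X F \<rho> p `` {(U, s)}"

definition stalk ::
    "'p topology \<Rightarrow> ('p set \<Rightarrow> ('a, 'c) module) \<Rightarrow> ('p set \<Rightarrow> 'p set \<Rightarrow> 'c \<Rightarrow> 'c) \<Rightarrow> 'p \<Rightarrow>
      ('a, ('p set \<times> 'c) set) module"
  where "stalk X F \<rho> p =
    \<lparr>carrier = local_sections X F p // germ_rel X F \<rho> p,
     mult = undefined,
     one = undefined,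
     zero = germ X F \<rho> p (topspace X) \<zero>\<^bsub>F (topspace X)\<^esub>,
     add = (\<lambda>A B. \<Union>(U, s) \<in> A. \<Union>(V, t) \<in> B.
              germ X F \<rho> p (U \<inter> V) (\<rho> U (U \<inter> V) s \<oplus>\<^bsub>F (U \<inter> V)\<^esub> \<rho> V (U \<inter> V) t)),
     smult = (\<lambda>a A. \<Union>(U, s) \<in> A. germ X F \<rho> p U (a \<odot>\<^bsub>F U\<^esub> s))\<rparr>"

definition structure_sheaf_stalk ::
    "('a, 'r) ring_scheme \<Rightarrow> ('a, 'b, 'm) module_scheme \<Rightarrow> 'b set \<Rightarrow>
      ('a, ('b set set \<times> ('b set \<Rightarrow> ('b \<times> 'a) set)) set) module"
  where "structure_sheaf_stalk R M P =
    stalk (zariski_topology R M) (structure_sheaf R M) section_restrict P"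


section \<open>Isomorphism of modules\<close>

definition module_iso ::
    "('a, 'r) ring_scheme \<Rightarrow> ('a, 'b, 'm) module_scheme \<Rightarrow> ('a, 'c, 'n) module_scheme \<Rightarrow>
      ('b \<Rightarrow> 'c) set"
  where "module_iso R A B =
    {f. bij_betw f (carrier A) (carrier B) \<and>
      (\<forall>x \<in> carrier A. \<forall>y \<in> carrier A. f (x \<oplus>\<^bsub>A\<^esub> y) = f x \<oplus>\<^bsub>B\<^esub> f y) \<and>
      (\<forall>a \<in> carrier R. \<forall>x \<in> carrier A. f (a \<odot>\<^bsub>A\<^esub> x) = a \<odot>\<^bsub>B\<^esub> f x)}"

definition module_isomorphic ::
    "('a, 'r) ring_scheme \<Rightarrow> ('a, 'b, 'm) module_scheme \<Rightarrow> ('a, 'c, 'n) module_scheme \<Rightarrow> bool"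
  where "module_isomorphic R A B \<longleftrightarrow>
    Module.module R A \<and> Module.module R B \<and> module_iso R A B \<noteq> {}"

end

theory Submission
  imports Defs
begin

text \<open>
  Evaluating a section at \<open>P\<close> gives a map from the stalk to the localization. It is injective
  because an equality of fractions at \<open>P\<close> is witnessed by a single ring element outside
  \<open>(P : M)\<close> and hence persists on a basic open neighbourhood of \<open>P\<close>, and it is surjective
  because a fraction with denominator \<open>g\<close> defines a section over the basic open set of all
  \<open>Q\<close> with \<open>g \<notin> (Q : M)\<close>. The operations of the stalk are determined by their values at
  \<open>P\<close>, so its module structure is the one transported along this bijection.
\<close>

section \<open>Localization at a multiplicative set\<close>

text \<open>Sections and germs compare fractions at every point of an open set, so the localization
  is developed for an arbitrary multiplicative set and interpreted anew at each point.\<close>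

locale module_localization = Module.module +
  fixes S
  assumes S_subset: "S \<subseteq> carrier R"
    and S_one: "\<one> \<in> S"
    and S_mult: "\<lbrakk>g \<in> S; h \<in> S\<rbrakk> \<Longrightarrow> g \<otimes> h \<in> S"
begin

section \<open>Fractions as equivalence classes\<close>

lemma S_closed: "g \<in> S \<Longrightarrow> g \<in> carrier R"
  using S_subset by blast

text \<open>Distributing \<open>u\<close> over the difference turns the defining condition into an
  equation without subtraction. With all scalars collected in the ring, later identities reduce to
  rearranging products in \<open>R\<close>.\<close>

lemma frac_rel_iff:
  "((m, g), (n, h)) \<in> frac_rel R M S \<longleftrightarrow>
    m \<in> carrier M \<and> g \<in> S \<and> n \<in> carrier M \<and> h \<in> S \<and>
    (\<exists>u\<in>S. (u \<otimes> h) \<odot>\<^bsub>M\<^esub> m = (u \<otimes> g) \<odot>\<^bsub>M\<^esub> n)"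
proof -
  have "u \<odot>\<^bsub>M\<^esub> (h \<odot>\<^bsub>M\<^esub> m \<ominus>\<^bsub>M\<^esub> g \<odot>\<^bsub>M\<^esub> n) = \<zero>\<^bsub>M\<^esub> \<longleftrightarrow>
      (u \<otimes> h) \<odot>\<^bsub>M\<^esub> m = (u \<otimes> g) \<odot>\<^bsub>M\<^esub> n"
    if "m \<in> carrier M" "n \<in> carrier M" "g \<in> S" "h \<in> S" "u \<in> S" for u
  proof -
    have "u \<odot>\<^bsub>M\<^esub> (h \<odot>\<^bsub>M\<^esub> m \<ominus>\<^bsub>M\<^esub> g \<odot>\<^bsub>M\<^esub> n) =
        (u \<otimes> h) \<odot>\<^bsub>M\<^esub> m \<ominus>\<^bsub>M\<^esub> (u \<otimes> g) \<odot>\<^bsub>M\<^esub> n"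
      using that S_closed by (simp add: a_minus_def smult_r_distr smult_r_minus smult_assoc1)
    moreover have "x \<ominus>\<^bsub>M\<^esub> y = \<zero>\<^bsub>M\<^esub> \<longleftrightarrow> x = y" if "x \<in> carrier M" "y \<in> carrier M" for x y
      using that by (metis M.minus_eq M.minus_equality M.minus_minus M.a_inv_closed M.r_neg)
    ultimately show ?thesis
      using that S_closed by simp
  qed
  then show ?thesis
    by (auto simp: frac_rel_def)
qed

text \<open>Only transitivity takes work. If \<open>u\<close> and \<open>v\<close> witness the two
  given relations and \<open>h\<close> is the middle denominator, then the product of
  \<open>u\<close>, \<open>v\<close> and \<open>h\<close> witnesses the composite; it lies in
  \<open>S\<close> because \<open>S\<close> is closed under products.\<close>

lemma equiv_frac_rel: "equiv (carrier M \<times> S) (frac_rel R M S)"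
proof (rule equivI)
  show "frac_rel R M S \<subseteq> (carrier M \<times> S) \<times> carrier M \<times> S"
    by (auto simp: frac_rel_def)
  show "refl_on (carrier M \<times> S) (frac_rel R M S)"
    using S_one by (auto simp: refl_on_def frac_rel_iff)
  show "sym (frac_rel R M S)"
    by (rule symI) (auto simp: frac_rel_iff, metis)
  show "trans (frac_rel R M S)"
  proof (rule transI, clarify)
    fix m g n h p k
    assume "((m, g), (n, h)) \<in> frac_rel R M S" "((n, h), (p, k)) \<in> frac_rel R M S"
    then obtain u v where in_M: "m \<in> carrier M" "n \<in> carrier M" "p \<in> carrier M"
      and in_S: "g \<in> S" "h \<in> S" "k \<in> S" "u \<in> S" "v \<in> S"
      and u: "(u \<otimes> h) \<odot>\<^bsub>M\<^esub> m = (u \<otimes> g) \<odot>\<^bsub>M\<^esub> n"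
      and v: "(v \<otimes> k) \<odot>\<^bsub>M\<^esub> n = (v \<otimes> h) \<odot>\<^bsub>M\<^esub> p"
      by (auto simp: frac_rel_iff)
    note closed = in_M in_S[THEN S_closed]
    have "(u \<otimes> v \<otimes> h \<otimes> k) \<odot>\<^bsub>M\<^esub> m = (v \<otimes> k) \<odot>\<^bsub>M\<^esub> ((u \<otimes> h) \<odot>\<^bsub>M\<^esub> m)"
      using closed by (simp add: smult_assoc1[symmetric] R.m_ac)
    also have "\<dots> = (u \<otimes> g) \<odot>\<^bsub>M\<^esub> ((v \<otimes> k) \<odot>\<^bsub>M\<^esub> n)"
      unfolding u using closed by (simp add: smult_assoc1[symmetric] R.m_ac)
    also have "\<dots> = (u \<otimes> v \<otimes> h \<otimes> g) \<odot>\<^bsub>M\<^esub> p"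
      unfolding v using closed by (simp add: smult_assoc1[symmetric] R.m_ac)
    finally show "((m, g), (p, k)) \<in> frac_rel R M S"
      unfolding frac_rel_iff using in_M in_S S_mult by blast
  qed
qed

lemma frac_eq_iff:
  assumes "m \<in> carrier M" "n \<in> carrier M" "g \<in> S" "h \<in> S"
  shows "frac R M S m g = frac R M S n h \<longleftrightarrow>
    (\<exists>u\<in>S. (u \<otimes> h) \<odot>\<^bsub>M\<^esub> m = (u \<otimes> g) \<odot>\<^bsub>M\<^esub> n)"
  using assms eq_equiv_class_iff[OF equiv_frac_rel, of "(m, g)" "(n, h)"]
  by (simp add: frac_def frac_rel_iff)

lemma frac_eqI:
  assumes "m \<in> carrier M" "n \<in> carrier M" "g \<in> S" "h \<in> S"
    and "h \<odot>\<^bsub>M\<^esub> m = g \<odot>\<^bsub>M\<^esub> n"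
  shows "frac R M S m g = frac R M S n h"
  using assms S_one S_closed by (auto simp: frac_eq_iff intro!: bexI[of _ \<one>])

lemma frac_closed: "\<lbrakk>m \<in> carrier M; g \<in> S\<rbrakk> \<Longrightarrow> frac R M S m g \<in> carrier (localization R M S)"
  by (auto simp: localization_def frac_def intro: quotientI)

lemma frac_cases:
  assumes "X \<in> carrier (localization R M S)"
  obtains m g where "m \<in> carrier M" "g \<in> S" "X = frac R M S m g"
  using assms by (auto simp: localization_def frac_def elim!: quotientE)

text \<open>The operations of the localization are unions over all representatives of their
  arguments. This lets such a union be evaluated by comparing fractions instead of unfolding the
  relation.\<close>

lemma in_frac_iff:
  assumes "m \<in> carrier M" "g \<in> S"
  shows "(n, h) \<in> frac R M S m g \<longleftrightarrow>
    n \<in> carrier M \<and> h \<in> S \<and> frac R M S n h = frac R M S m g"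
  using assms eq_equiv_class_iff[OF equiv_frac_rel, of "(m, g)" "(n, h)"]
  by (auto simp: frac_def frac_rel_iff)

section \<open>Arithmetic of fractions\<close>

lemma zero_localization: "\<zero>\<^bsub>localization R M S\<^esub> = frac R M S \<zero>\<^bsub>M\<^esub> \<one>"
  by (simp add: localization_def)

lemma add_numerator_closed:
  "\<lbrakk>m \<in> carrier M; n \<in> carrier M; g \<in> S; h \<in> S\<rbrakk> \<Longrightarrow>
    h \<odot>\<^bsub>M\<^esub> m \<oplus>\<^bsub>M\<^esub> g \<odot>\<^bsub>M\<^esub> n \<in> carrier M"
  using S_closed by simp

text \<open>Let \<open>u\<close> and \<open>v\<close> witness the two equalities of fractions.
  Scaling the first equation by \<open>v\<close>, \<open>h'\<close> and \<open>h\<close>, the second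
  by \<open>u\<close>, \<open>g'\<close> and \<open>g\<close>, and adding shows that the product of
  \<open>u\<close> and \<open>v\<close> witnesses the equality of the sums.\<close>

lemma frac_add_cong:
  assumes in_M: "m \<in> carrier M" "m' \<in> carrier M" "n \<in> carrier M" "n' \<in> carrier M"
    and in_S: "g \<in> S" "g' \<in> S" "h \<in> S" "h' \<in> S"
    and "frac R M S m g = frac R M S m' g'" "frac R M S n h = frac R M S n' h'"
  shows "frac R M S (h \<odot>\<^bsub>M\<^esub> m \<oplus>\<^bsub>M\<^esub> g \<odot>\<^bsub>M\<^esub> n) (g \<otimes> h) =
    frac R M S (h' \<odot>\<^bsub>M\<^esub> m' \<oplus>\<^bsub>M\<^esub> g' \<odot>\<^bsub>M\<^esub> n') (g' \<otimes> h')"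
proof -
  obtain u v where uv: "u \<in> S" "v \<in> S"
    and u: "(u \<otimes> g') \<odot>\<^bsub>M\<^esub> m = (u \<otimes> g) \<odot>\<^bsub>M\<^esub> m'"
    and v: "(v \<otimes> h') \<odot>\<^bsub>M\<^esub> n = (v \<otimes> h) \<odot>\<^bsub>M\<^esub> n'"
    using assms by (auto simp: frac_eq_iff)
  note closed = in_M in_S[THEN S_closed] uv[THEN S_closed]
  have "(u \<otimes> v \<otimes> (g' \<otimes> h')) \<odot>\<^bsub>M\<^esub> (h \<odot>\<^bsub>M\<^esub> m \<oplus>\<^bsub>M\<^esub> g \<odot>\<^bsub>M\<^esub> n) =
      (v \<otimes> h' \<otimes> h) \<odot>\<^bsub>M\<^esub> ((u \<otimes> g') \<odot>\<^bsub>M\<^esub> m) \<oplus>\<^bsub>M\<^esub>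
      (u \<otimes> g' \<otimes> g) \<odot>\<^bsub>M\<^esub> ((v \<otimes> h') \<odot>\<^bsub>M\<^esub> n)"
    using closed by (simp add: smult_r_distr smult_assoc1[symmetric] R.m_ac)
  also have "\<dots> = (u \<otimes> v \<otimes> (g \<otimes> h)) \<odot>\<^bsub>M\<^esub> (h' \<odot>\<^bsub>M\<^esub> m' \<oplus>\<^bsub>M\<^esub> g' \<odot>\<^bsub>M\<^esub> n')"
    unfolding u v using closed by (simp add: smult_r_distr smult_assoc1[symmetric] R.m_ac)
  finally show ?thesis
    using in_M in_S uv S_mult add_numerator_closed by (subst frac_eq_iff) auto
qed

lemma frac_smult_cong:
  assumes in_M: "m \<in> carrier M" "m' \<in> carrier M" and in_S: "g \<in> S" "g' \<in> S"
    and a: "a \<in> carrier R"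
    and eq: "frac R M S m g = frac R M S m' g'"
  shows "frac R M S (a \<odot>\<^bsub>M\<^esub> m) g = frac R M S (a \<odot>\<^bsub>M\<^esub> m') g'"
proof -
  obtain u where uS: "u \<in> S" and u: "(u \<otimes> g') \<odot>\<^bsub>M\<^esub> m = (u \<otimes> g) \<odot>\<^bsub>M\<^esub> m'"
    using assms by (auto simp: frac_eq_iff)
  note closed = in_M in_S[THEN S_closed] S_closed[OF uS] a
  have "(u \<otimes> g') \<odot>\<^bsub>M\<^esub> (a \<odot>\<^bsub>M\<^esub> m) = a \<odot>\<^bsub>M\<^esub> ((u \<otimes> g') \<odot>\<^bsub>M\<^esub> m)"
    using closed by (simp add: smult_assoc1[symmetric] R.m_ac)
  also have "\<dots> = (u \<otimes> g) \<odot>\<^bsub>M\<^esub> (a \<odot>\<^bsub>M\<^esub> m')"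
    unfolding u using closed by (simp add: smult_assoc1[symmetric] R.m_ac)
  finally show ?thesis
    using in_M in_S a uS by (subst frac_eq_iff) auto
qed

text \<open>By \<open>frac_add_cong\<close> every pair of representatives contributes the same set
  to the union in the definition, and at least one pair exists, so the union is that set.\<close>

lemma add_frac:
  assumes "m \<in> carrier M" "n \<in> carrier M" "g \<in> S" "h \<in> S"
  shows "frac R M S m g \<oplus>\<^bsub>localization R M S\<^esub> frac R M S n h =
    frac R M S (h \<odot>\<^bsub>M\<^esub> m \<oplus>\<^bsub>M\<^esub> g \<odot>\<^bsub>M\<^esub> n) (g \<otimes> h)" (is "_ = ?r")
proof -
  have "(m, g) \<in> frac R M S m g" "(n, h) \<in> frac R M S n h"
    using assms by (simp_all add: in_frac_iff)
  moreover have "frac R M S (h' \<odot>\<^bsub>M\<^esub> m' \<oplus>\<^bsub>M\<^esub> g' \<odot>\<^bsub>M\<^esub> n') (g' \<otimes> h') = ?r"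
    if "(m', g') \<in> frac R M S m g" "(n', h') \<in> frac R M S n h" for m' g' n' h'
    using that assms by (intro frac_add_cong) (auto simp: in_frac_iff)
  ultimately have "(\<Union>(m', g')\<in>frac R M S m g. \<Union>(n', h')\<in>frac R M S n h.
      frac R M S (h' \<odot>\<^bsub>M\<^esub> m' \<oplus>\<^bsub>M\<^esub> g' \<odot>\<^bsub>M\<^esub> n') (g' \<otimes> h')) = ?r"
    by fast
  then show ?thesis
    by (simp add: localization_def)
qed

lemma smult_frac:
  assumes "m \<in> carrier M" "g \<in> S" "a \<in> carrier R"
  shows "a \<odot>\<^bsub>localization R M S\<^esub> frac R M S m g = frac R M S (a \<odot>\<^bsub>M\<^esub> m) g" (is "_ = ?r")
proof -
  have "(m, g) \<in> frac R M S m g"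
    using assms by (simp add: in_frac_iff)
  moreover have "frac R M S (a \<odot>\<^bsub>M\<^esub> m') g' = ?r" if "(m', g') \<in> frac R M S m g" for m' g'
    using that assms by (intro frac_smult_cong) (auto simp: in_frac_iff)
  ultimately have "(\<Union>(m', g')\<in>frac R M S m g. frac R M S (a \<odot>\<^bsub>M\<^esub> m') g') = ?r"
    by fast
  then show ?thesis
    by (simp add: localization_def)
qed

section \<open>The module axioms for the localization\<close>

lemma abelian_group_localization: "abelian_group (localization R M S)"
proof (rule abelian_groupI)
  let ?L = "localization R M S"
  note closed = S_closed S_one S_mult frac_closed add_numerator_closed
  note rules = add_frac zero_localization
  show "\<zero>\<^bsub>?L\<^esub> \<in> carrier ?L"
    by (simp add: rules closed)
  fix X assume "X \<in> carrier ?L"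
  then obtain m g where X: "m \<in> carrier M" "g \<in> S" "X = frac R M S m g"
    by (rule frac_cases)
  then show "\<zero>\<^bsub>?L\<^esub> \<oplus>\<^bsub>?L\<^esub> X = X"
    by (simp add: rules closed)
  \<comment> \<open>The sum comes out as zero over \<open>g \<otimes> g\<close>, which still has to
    be identified with zero over one.\<close>
  have "frac R M S (\<ominus>\<^bsub>M\<^esub> m) g \<oplus>\<^bsub>?L\<^esub> X = \<zero>\<^bsub>?L\<^esub>"
    using X frac_eqI[of "\<zero>\<^bsub>M\<^esub>" "\<zero>\<^bsub>M\<^esub>" "g \<otimes> g" \<one>]
    by (simp add: rules closed smult_r_minus M.l_neg)
  then show "\<exists>Y\<in>carrier ?L. Y \<oplus>\<^bsub>?L\<^esub> X = \<zero>\<^bsub>?L\<^esub>"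
    using X frac_closed[of "\<ominus>\<^bsub>M\<^esub> m" g] by auto
  fix Y assume "Y \<in> carrier ?L"
  then obtain n h where Y: "n \<in> carrier M" "h \<in> S" "Y = frac R M S n h"
    by (rule frac_cases)
  show "X \<oplus>\<^bsub>?L\<^esub> Y \<in> carrier ?L"
    using X Y by (simp add: rules closed)
  show "X \<oplus>\<^bsub>?L\<^esub> Y = Y \<oplus>\<^bsub>?L\<^esub> X"
    using X Y by (simp add: rules closed M.a_comm R.m_comm)
  fix Z assume "Z \<in> carrier ?L"
  then obtain p k where Z: "p \<in> carrier M" "k \<in> S" "Z = frac R M S p k"
    by (rule frac_cases)
  \<comment> \<open>Both bracketings give the same numerator and, up to associativity in
    \<open>R\<close>, the same denominator, so no witness in \<open>S\<close> is needed.\<close>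
  have "k \<odot>\<^bsub>M\<^esub> (h \<odot>\<^bsub>M\<^esub> m \<oplus>\<^bsub>M\<^esub> g \<odot>\<^bsub>M\<^esub> n) \<oplus>\<^bsub>M\<^esub> (g \<otimes> h) \<odot>\<^bsub>M\<^esub> p =
      (h \<otimes> k) \<odot>\<^bsub>M\<^esub> m \<oplus>\<^bsub>M\<^esub> g \<odot>\<^bsub>M\<^esub> (k \<odot>\<^bsub>M\<^esub> n \<oplus>\<^bsub>M\<^esub> h \<odot>\<^bsub>M\<^esub> p)"
    using X Y Z S_closed
    by (simp add: smult_r_distr smult_assoc1[symmetric] R.m_comm M.a_assoc)
  then show "X \<oplus>\<^bsub>?L\<^esub> Y \<oplus>\<^bsub>?L\<^esub> Z = X \<oplus>\<^bsub>?L\<^esub> (Y \<oplus>\<^bsub>?L\<^esub> Z)"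
    using X Y Z by (simp add: rules closed R.m_assoc)
qed

lemma module_localization: "Module.module R (localization R M S)"
proof (rule moduleI)
  let ?L = "localization R M S"
  note closed = S_closed S_one S_mult frac_closed add_numerator_closed
  note rules = add_frac smult_frac
  show "cring R" "abelian_group ?L"
    by (rule R.cring_axioms abelian_group_localization)+
  fix X assume "X \<in> carrier ?L"
  then obtain m g where X: "m \<in> carrier M" "g \<in> S" "X = frac R M S m g"
    by (rule frac_cases)
  show "\<one> \<odot>\<^bsub>?L\<^esub> X = X"
    using X by (simp add: rules)
  fix a assume a: "a \<in> carrier R"
  show "a \<odot>\<^bsub>?L\<^esub> X \<in> carrier ?L"
    using X a by (simp add: rules closed)
  {
    fix b assume b: "b \<in> carrier R"
    show "(a \<otimes> b) \<odot>\<^bsub>?L\<^esub> X = a \<odot>\<^bsub>?L\<^esub> (b \<odot>\<^bsub>?L\<^esub> X)"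
      using X a b by (simp add: rules smult_assoc1)
    \<comment> \<open>Adding two fractions with denominator \<open>g\<close> yields denominator
      \<open>g \<otimes> g\<close>, so distributivity over scalars holds only after cancelling one
      factor \<open>g\<close>.\<close>
    have "frac R M S ((a \<oplus> b) \<odot>\<^bsub>M\<^esub> m) g =
        frac R M S (g \<odot>\<^bsub>M\<^esub> (a \<odot>\<^bsub>M\<^esub> m) \<oplus>\<^bsub>M\<^esub> g \<odot>\<^bsub>M\<^esub> (b \<odot>\<^bsub>M\<^esub> m)) (g \<otimes> g)"
    proof (rule frac_eqI)
      show "(g \<otimes> g) \<odot>\<^bsub>M\<^esub> ((a \<oplus> b) \<odot>\<^bsub>M\<^esub> m) =
          g \<odot>\<^bsub>M\<^esub> (g \<odot>\<^bsub>M\<^esub> (a \<odot>\<^bsub>M\<^esub> m) \<oplus>\<^bsub>M\<^esub> g \<odot>\<^bsub>M\<^esub> (b \<odot>\<^bsub>M\<^esub> m))"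
        using X a b S_closed by (simp add: smult_l_distr smult_r_distr smult_assoc1)
    qed (use X a b closed in auto)
    then show "(a \<oplus> b) \<odot>\<^bsub>?L\<^esub> X = a \<odot>\<^bsub>?L\<^esub> X \<oplus>\<^bsub>?L\<^esub> b \<odot>\<^bsub>?L\<^esub> X"
      using X a b by (simp add: rules)
  }
  fix Y assume "Y \<in> carrier ?L"
  then obtain n h where Y: "n \<in> carrier M" "h \<in> S" "Y = frac R M S n h"
    by (rule frac_cases)
  have "a \<odot>\<^bsub>M\<^esub> (h \<odot>\<^bsub>M\<^esub> m \<oplus>\<^bsub>M\<^esub> g \<odot>\<^bsub>M\<^esub> n) =
      h \<odot>\<^bsub>M\<^esub> (a \<odot>\<^bsub>M\<^esub> m) \<oplus>\<^bsub>M\<^esub> g \<odot>\<^bsub>M\<^esub> (a \<odot>\<^bsub>M\<^esub> n)"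
    using X Y a S_closed by (simp add: smult_r_distr smult_assoc1[symmetric] R.m_comm)
  then show "a \<odot>\<^bsub>?L\<^esub> (X \<oplus>\<^bsub>?L\<^esub> Y) = a \<odot>\<^bsub>?L\<^esub> X \<oplus>\<^bsub>?L\<^esub> a \<odot>\<^bsub>?L\<^esub> Y"
    using X Y a by (simp add: rules closed)
qed

end


section \<open>Sections of the structure sheaf\<close>

context Module.module
begin

text \<open>One lies outside (Q : M) because Q is proper, and closure of the complement under
  products is the primeness of (Q : M), supplied by \<open>colon_prime\<close>.\<close>

lemma module_localization_prime:
  assumes "Q \<in> mSpec R M"
  shows "module_localization R M (carrier R - colon R M Q)"
proof -
  have Q: "prime_submodule R M Q"
    using assms by (simp add: mSpec_def)
  have "\<one> \<notin> colon R M Q"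
  proof
    assume "\<one> \<in> colon R M Q"
    then have "carrier M \<subseteq> Q"
      by (auto simp: colon_def)
    with Q show False
      using submoduleE(1) by (auto simp: prime_submodule_def)
  qed
  then show ?thesis
    using colon_prime[OF Q] by unfold_locales auto
qed

lemma submodule_smult_image:
  assumes "g \<in> carrier R"
  shows "submodule ((\<lambda>x. g \<odot>\<^bsub>M\<^esub> x) ` carrier M) R M"
proof (rule submoduleI)
  show "(\<lambda>x. g \<odot>\<^bsub>M\<^esub> x) ` carrier M \<subseteq> carrier M"
    using assms by auto
  show "\<zero>\<^bsub>M\<^esub> \<in> (\<lambda>x. g \<odot>\<^bsub>M\<^esub> x) ` carrier M"
    using assms by (intro image_eqI[of _ _ "\<zero>\<^bsub>M\<^esub>"]) auto
next
  fix a assume "a \<in> (\<lambda>x. g \<odot>\<^bsub>M\<^esub> x) ` carrier M"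
  then show "\<ominus>\<^bsub>M\<^esub> a \<in> (\<lambda>x. g \<odot>\<^bsub>M\<^esub> x) ` carrier M"
    using assms by (auto simp: smult_r_minus[symmetric])
next
  fix a b assume "a \<in> (\<lambda>x. g \<odot>\<^bsub>M\<^esub> x) ` carrier M" "b \<in> (\<lambda>x. g \<odot>\<^bsub>M\<^esub> x) ` carrier M"
  then show "a \<oplus>\<^bsub>M\<^esub> b \<in> (\<lambda>x. g \<odot>\<^bsub>M\<^esub> x) ` carrier M"
    using assms by (auto simp: smult_r_distr[symmetric])
next
  fix r a assume "r \<in> carrier R" "a \<in> (\<lambda>x. g \<odot>\<^bsub>M\<^esub> x) ` carrier M"
  then obtain x where "x \<in> carrier M" "a = g \<odot>\<^bsub>M\<^esub> x"
    by blast
  moreover from this have "r \<odot>\<^bsub>M\<^esub> a = g \<odot>\<^bsub>M\<^esub> (r \<odot>\<^bsub>M\<^esub> x)"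
    using \<open>r \<in> carrier R\<close> assms by (simp add: smult_assoc1[symmetric] R.m_comm)
  ultimately show "r \<odot>\<^bsub>M\<^esub> a \<in> (\<lambda>x. g \<odot>\<^bsub>M\<^esub> x) ` carrier M"
    using \<open>r \<in> carrier R\<close> by auto
qed

text \<open>The complement is the closed set V(gM): \<open>g\<close> itself lies in (gM : M), and
  conversely gM contained in Q forces every \<open>r\<close> with rM contained in gM into (Q :
  M).\<close>

lemma openin_basic:
  assumes "g \<in> carrier R"
  shows "openin (zariski_topology R M) {Q \<in> mSpec R M. g \<notin> colon R M Q}"
proof -
  let ?N = "(\<lambda>x. g \<odot>\<^bsub>M\<^esub> x) ` carrier M"
  have "colon R M ?N \<subseteq> colon R M Q \<longleftrightarrow> g \<in> colon R M Q" for Q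
    using assms by (fastforce simp: colon_def)
  then have "{Q \<in> mSpec R M. g \<notin> colon R M Q} = mSpec R M - zariski_V R M ?N"
    by (auto simp: zariski_V_def)
  then show ?thesis
    using submodule_smult_image[OF assms] unfolding openin_zariski by blast
qed

lemma openin_zariski_subset:
  "openin (zariski_topology R M) U \<Longrightarrow> U \<subseteq> mSpec R M"
  using openin_subset[of "zariski_topology R M" U] by (simp add: topspace_zariski)

lemma module_localization_open:
  "\<lbrakk>openin (zariski_topology R M) U; Q \<in> U\<rbrakk> \<Longrightarrow>
    module_localization R M (carrier R - colon R M Q)"
  using openin_zariski_subset module_localization_prime by blast

section \<open>Sections and the operations on them\<close>

lemma sections_closed:
  "\<lbrakk>s \<in> sections R M U; Q \<in> U\<rbrakk> \<Longrightarrow> s Q \<in> carrier (localization_at R M (colon R M Q))"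
  by (auto simp: sections_def)

lemma sections_local:
  assumes "s \<in> sections R M U" "Q \<in> U"
  obtains W m g where "openin (zariski_topology R M) W" "Q \<in> W" "W \<subseteq> U"
    "m \<in> carrier M" "g \<in> carrier R"
    "\<And>Q. Q \<in> W \<Longrightarrow> g \<notin> colon R M Q"
    "\<And>Q. Q \<in> W \<Longrightarrow> s Q = frac R M (carrier R - colon R M Q) m g"
proof -
  from assms have "\<exists>W m g. openin (zariski_topology R M) W \<and> Q \<in> W \<and> W \<subseteq> U \<and>
      m \<in> carrier M \<and> g \<in> carrier R \<and>
      (\<forall>Q\<in>W. g \<notin> colon R M Q \<and> s Q = frac R M (carrier R - colon R M Q) m g)"
    by (simp add: sections_def)
  then show ?thesis
    by (elim exE conjE) (rule that, assumption+, simp_all)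
qed

text \<open>That each value lies in the right localization already follows from its local
  description as a fraction, so only extensionality and that description have to be checked.\<close>

lemma sectionsI:
  assumes U: "openin (zariski_topology R M) U"
    and ext: "s \<in> extensional U"
    and loc: "\<And>Q. Q \<in> U \<Longrightarrow> \<exists>W m g. openin (zariski_topology R M) W \<and> Q \<in> W \<and> W \<subseteq> U \<and>
      m \<in> carrier M \<and> g \<in> carrier R \<and>
      (\<forall>Q\<in>W. g \<notin> colon R M Q \<and> s Q = frac R M (carrier R - colon R M Q) m g)"
  shows "s \<in> sections R M U"
proof -
  have "s Q \<in> carrier (localization_at R M (colon R M Q))" if "Q \<in> U" for Q
  proof -
    interpret module_localization R M "carrier R - colon R M Q"
      by (rule module_localization_open[OF U that])
    show ?thesis
      using loc[OF that] frac_closed by (force simp: localization_at_def)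
  qed
  then show ?thesis
    using ext loc by (simp add: sections_def PiE_def)
qed

lemma restrict_sections:
  assumes s: "s \<in> sections R M U"
    and V: "openin (zariski_topology R M) V" "V \<subseteq> U"
  shows "restrict s V \<in> sections R M V"
proof (rule sectionsI[OF V(1)])
  fix Q assume "Q \<in> V"
  then have "Q \<in> U"
    using V(2) by blast
  with s obtain W m g where W: "openin (zariski_topology R M) W" "Q \<in> W"
    and "m \<in> carrier M" "g \<in> carrier R"
    and "\<And>Q. Q \<in> W \<Longrightarrow> g \<notin> colon R M Q"
    and "\<And>Q. Q \<in> W \<Longrightarrow> s Q = frac R M (carrier R - colon R M Q) m g"
    by (rule sections_local) blast
  then have "\<forall>Q\<in>W \<inter> V. g \<notin> colon R M Q \<and>
      restrict s V Q = frac R M (carrier R - colon R M Q) m g"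
    by simp
  moreover have "openin (zariski_topology R M) (W \<inter> V)" "Q \<in> W \<inter> V" "W \<inter> V \<subseteq> V"
    using W V(1) \<open>Q \<in> V\<close> by (simp_all add: openin_Int)
  ultimately show "\<exists>W m g. openin (zariski_topology R M) W \<and> Q \<in> W \<and> W \<subseteq> V \<and>
      m \<in> carrier M \<and> g \<in> carrier R \<and>
      (\<forall>Q\<in>W. g \<notin> colon R M Q \<and> restrict s V Q = frac R M (carrier R - colon R M Q) m g)"
    using \<open>m \<in> carrier M\<close> \<open>g \<in> carrier R\<close> by metis
qed auto

text \<open>On the intersection of two neighbourhoods where the summands are fixed fractions, the
  sum formula uses the same numerator and denominator at every point. Primeness of each (Q : M)
  keeps the product \<open>g \<otimes> h\<close> an admissible denominator.\<close>

lemma add_sections: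
  assumes U: "openin (zariski_topology R M) U"
    and s: "s \<in> sections R M U" and t: "t \<in> sections R M U"
  shows "s \<oplus>\<^bsub>structure_sheaf R M U\<^esub> t \<in> sections R M U"
proof (rule sectionsI[OF U])
  fix Q assume "Q \<in> U"
  with s obtain W m g where W: "openin (zariski_topology R M) W" "Q \<in> W" "W \<subseteq> U"
    and m: "m \<in> carrier M" and g: "g \<in> carrier R" "\<And>Q. Q \<in> W \<Longrightarrow> g \<notin> colon R M Q"
    and s_eq: "\<And>Q. Q \<in> W \<Longrightarrow> s Q = frac R M (carrier R - colon R M Q) m g"
    by (rule sections_local) blast
  from t \<open>Q \<in> U\<close> obtain W' n h where W': "openin (zariski_topology R M) W'" "Q \<in> W'"
    and n: "n \<in> carrier M" and h: "h \<in> carrier R" "\<And>Q. Q \<in> W' \<Longrightarrow> h \<notin> colon R M Q"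
    and t_eq: "\<And>Q. Q \<in> W' \<Longrightarrow> t Q = frac R M (carrier R - colon R M Q) n h"
    by (rule sections_local) blast
  have "g \<otimes> h \<notin> colon R M Q' \<and> (s \<oplus>\<^bsub>structure_sheaf R M U\<^esub> t) Q' =
      frac R M (carrier R - colon R M Q') (h \<odot>\<^bsub>M\<^esub> m \<oplus>\<^bsub>M\<^esub> g \<odot>\<^bsub>M\<^esub> n) (g \<otimes> h)"
    if "Q' \<in> W \<inter> W'" for Q'
  proof -
    interpret module_localization R M "carrier R - colon R M Q'"
      using W(1) that by (blast intro: module_localization_open)
    have Q': "Q' \<in> U" "g \<in> carrier R - colon R M Q'" "h \<in> carrier R - colon R M Q'"
      using that W(3) g h by auto
    then have "g \<otimes> h \<notin> colon R M Q'"
      using S_mult by blast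
    moreover have "(s \<oplus>\<^bsub>structure_sheaf R M U\<^esub> t) Q' =
        s Q' \<oplus>\<^bsub>localization R M (carrier R - colon R M Q')\<^esub> t Q'"
      using Q' by (simp add: structure_sheaf_def localization_at_def)
    ultimately show ?thesis
      using that add_frac[OF m n Q'(2,3)] by (simp only: s_eq t_eq Int_iff simp_thms)
  qed
  then have "\<forall>Q\<in>W \<inter> W'. g \<otimes> h \<notin> colon R M Q \<and> (s \<oplus>\<^bsub>structure_sheaf R M U\<^esub> t) Q =
      frac R M (carrier R - colon R M Q) (h \<odot>\<^bsub>M\<^esub> m \<oplus>\<^bsub>M\<^esub> g \<odot>\<^bsub>M\<^esub> n) (g \<otimes> h)"
    by blast
  moreover have "h \<odot>\<^bsub>M\<^esub> m \<oplus>\<^bsub>M\<^esub> g \<odot>\<^bsub>M\<^esub> n \<in> carrier M" "g \<otimes> h \<in> carrier R"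
    using m n g h by simp_all
  moreover have "openin (zariski_topology R M) (W \<inter> W')" "Q \<in> W \<inter> W'" "W \<inter> W' \<subseteq> U"
    using W W' by (auto simp: openin_Int)
  ultimately show "\<exists>W m g. openin (zariski_topology R M) W \<and> Q \<in> W \<and> W \<subseteq> U \<and>
      m \<in> carrier M \<and> g \<in> carrier R \<and> (\<forall>Q\<in>W. g \<notin> colon R M Q \<and>
      (s \<oplus>\<^bsub>structure_sheaf R M U\<^esub> t) Q = frac R M (carrier R - colon R M Q) m g)"
    by metis
qed (simp add: structure_sheaf_def)

lemma smult_sections:
  assumes U: "openin (zariski_topology R M) U"
    and s: "s \<in> sections R M U" and a: "a \<in> carrier R"
  shows "a \<odot>\<^bsub>structure_sheaf R M U\<^esub> s \<in> sections R M U"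
proof (rule sectionsI[OF U])
  fix Q assume "Q \<in> U"
  with s obtain W m g where W: "openin (zariski_topology R M) W" "Q \<in> W" "W \<subseteq> U"
    and m: "m \<in> carrier M" and g: "g \<in> carrier R" "\<And>Q. Q \<in> W \<Longrightarrow> g \<notin> colon R M Q"
    and s_eq: "\<And>Q. Q \<in> W \<Longrightarrow> s Q = frac R M (carrier R - colon R M Q) m g"
    by (rule sections_local) blast
  have "(a \<odot>\<^bsub>structure_sheaf R M U\<^esub> s) Q' =
      frac R M (carrier R - colon R M Q') (a \<odot>\<^bsub>M\<^esub> m) g" if "Q' \<in> W" for Q'
  proof -
    interpret module_localization R M "carrier R - colon R M Q'"
      using W(1) that by (rule module_localization_open)
    have Q': "Q' \<in> U" "g \<in> carrier R - colon R M Q'"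
      using that W(3) g by auto
    then have "(a \<odot>\<^bsub>structure_sheaf R M U\<^esub> s) Q' =
        a \<odot>\<^bsub>localization R M (carrier R - colon R M Q')\<^esub> s Q'"
      by (simp add: structure_sheaf_def localization_at_def)
    then show ?thesis
      using smult_frac[OF m Q'(2) a] by (simp only: s_eq[OF that])
  qed
  then show "\<exists>W m g. openin (zariski_topology R M) W \<and> Q \<in> W \<and> W \<subseteq> U \<and>
      m \<in> carrier M \<and> g \<in> carrier R \<and> (\<forall>Q\<in>W. g \<notin> colon R M Q \<and>
      (a \<odot>\<^bsub>structure_sheaf R M U\<^esub> s) Q = frac R M (carrier R - colon R M Q) m g)"
    using W m g a by (intro exI[of _ W] exI[of _ "a \<odot>\<^bsub>M\<^esub> m"] exI[of _ g]) auto
qed (simp add: structure_sheaf_def)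

lemma frac_sections:
  assumes U: "openin (zariski_topology R M) U"
    and "m \<in> carrier M" "g \<in> carrier R" "\<And>Q. Q \<in> U \<Longrightarrow> g \<notin> colon R M Q"
  shows "(\<lambda>Q\<in>U. frac R M (carrier R - colon R M Q) m g) \<in> sections R M U"
  using assms by (intro sectionsI[OF U]) auto

text \<open>The zero section is the fraction zero over one at every point. The whole spectrum is the
  relevant domain because the zero of the stalk is defined as a germ over the full space.\<close>

lemma zero_sections:
  "\<zero>\<^bsub>structure_sheaf R M (mSpec R M)\<^esub> \<in> sections R M (mSpec R M)"
proof -
  have "\<one> \<notin> colon R M Q" if "Q \<in> mSpec R M" for Q
    using module_localization.S_one[OF module_localization_prime[OF that]] by simp
  moreover have "openin (zariski_topology R M) (mSpec R M)"
    using openin_topspace topspace_zariski by metis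
  ultimately show ?thesis
    using frac_sections[of "mSpec R M" "\<zero>\<^bsub>M\<^esub>" \<one>]
    by (simp add: structure_sheaf_def localization_at_def localization_def)
qed

text \<open>
  Two fractions that agree at \<open>P\<close> are identified by multiplication with some \<open>u \<notin> (P : M)\<close>,
  so they agree on the whole open set where \<open>u\<close> and both denominators are invertible.
\<close>

lemma sections_eq_near:
  assumes s: "s \<in> sections R M U" "P \<in> U" and t: "t \<in> sections R M V" "P \<in> V"
    and eq: "s P = t P"
  obtains W where "openin (zariski_topology R M) W" "P \<in> W" "W \<subseteq> U \<inter> V"
    "restrict s W = restrict t W"
proof -
  from s obtain W m g where W: "openin (zariski_topology R M) W" "P \<in> W" "W \<subseteq> U"
    and m: "m \<in> carrier M" and g: "g \<in> carrier R" "\<And>Q. Q \<in> W \<Longrightarrow> g \<notin> colon R M Q"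
    and s_eq: "\<And>Q. Q \<in> W \<Longrightarrow> s Q = frac R M (carrier R - colon R M Q) m g"
    by (rule sections_local) blast
  from t obtain W' n h where W': "openin (zariski_topology R M) W'" "P \<in> W'" "W' \<subseteq> V"
    and n: "n \<in> carrier M" and h: "h \<in> carrier R" "\<And>Q. Q \<in> W' \<Longrightarrow> h \<notin> colon R M Q"
    and t_eq: "\<And>Q. Q \<in> W' \<Longrightarrow> t Q = frac R M (carrier R - colon R M Q) n h"
    by (rule sections_local) blast
  have P: "P \<in> mSpec R M"
    using W openin_zariski_subset by blast
  obtain u where u: "u \<in> carrier R" "u \<notin> colon R M P"
    "(u \<otimes> h) \<odot>\<^bsub>M\<^esub> m = (u \<otimes> g) \<odot>\<^bsub>M\<^esub> n"
    using module_localization.frac_eq_iff[OF module_localization_prime[OF P], of m n g h]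
      eq s_eq[of P] t_eq[of P] W W' m n g h by auto
  define D where "D = W \<inter> W' \<inter> {Q \<in> mSpec R M. u \<notin> colon R M Q}"
  have "openin (zariski_topology R M) D"
    using W W' openin_basic u by (auto simp: D_def intro: openin_Int)
  moreover have "P \<in> D" "D \<subseteq> U \<inter> V"
    using W W' P u by (auto simp: D_def)
  moreover have "s Q = t Q" if "Q \<in> D" for Q
  proof -
    have Q: "Q \<in> W" "Q \<in> W'" "Q \<in> mSpec R M" "u \<notin> colon R M Q"
      using that by (auto simp: D_def)
    interpret module_localization R M "carrier R - colon R M Q"
      using Q(3) by (rule module_localization_prime)
    show ?thesis
      using Q m n g h u by (auto simp: s_eq t_eq frac_eq_iff)
  qed
  then have "restrict s D = restrict t D"
    by (auto intro: restrict_ext)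
  ultimately show ?thesis
    by (rule that)
qed

end


section \<open>The stalk\<close>

text \<open>\<open>A\<close> is only assumed to be a record with closed operations. Both sides of
  each equational axiom have the same image under \<open>f\<close> in the module \<open>B\<close>,
  hence agree by injectivity; thus \<open>A\<close> is shown to be a module along with the
  isomorphism.\<close>

lemma module_isomorphicI:
  fixes A :: "('a, 'c, 'n) module_scheme"
  assumes B: "Module.module R B"
    and bij: "bij_betw f (carrier A) (carrier B)"
    and zero: "\<zero>\<^bsub>A\<^esub> \<in> carrier A" "f \<zero>\<^bsub>A\<^esub> = \<zero>\<^bsub>B\<^esub>"
    and add_closed: "\<And>x y. \<lbrakk>x \<in> carrier A; y \<in> carrier A\<rbrakk> \<Longrightarrow> x \<oplus>\<^bsub>A\<^esub> y \<in> carrier A"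
    and f_add: "\<And>x y. \<lbrakk>x \<in> carrier A; y \<in> carrier A\<rbrakk> \<Longrightarrow> f (x \<oplus>\<^bsub>A\<^esub> y) = f x \<oplus>\<^bsub>B\<^esub> f y"
    and smult_closed: "\<And>a x. \<lbrakk>a \<in> carrier R; x \<in> carrier A\<rbrakk> \<Longrightarrow> a \<odot>\<^bsub>A\<^esub> x \<in> carrier A"
    and f_smult: "\<And>a x. \<lbrakk>a \<in> carrier R; x \<in> carrier A\<rbrakk> \<Longrightarrow> f (a \<odot>\<^bsub>A\<^esub> x) = a \<odot>\<^bsub>B\<^esub> f x"
  shows "module_isomorphic R A B"
proof -
  interpret B: Module.module R B
    by (rule B)
  have inj: "x = y" if "f x = f y" "x \<in> carrier A" "y \<in> carrier A" for x y
    using that bij by (auto simp: bij_betw_def inj_on_def)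
  have f_closed: "f x \<in> carrier B" if "x \<in> carrier A" for x
    using that bij by (auto simp: bij_betw_def)
  note simps = zero add_closed f_add smult_closed f_smult f_closed
  have "Module.module R A"
  proof (rule moduleI)
    show "cring R"
      by (rule B.R.cring_axioms)
    show "abelian_group A"
    proof (rule abelian_groupI)
      fix x assume x: "x \<in> carrier A"
      \<comment> \<open>Existence of additive inverses is where surjectivity of \<open>f\<close>
        enters: the inverse of \<open>x\<close> is a preimage of the negative of
        \<open>f x\<close>.\<close>
      then obtain y where y: "y \<in> carrier A" "f y = \<ominus>\<^bsub>B\<^esub> f x"
        using bij f_closed B.M.a_inv_closed by (metis bij_betw_imp_surj_on imageE)
      then have "y \<oplus>\<^bsub>A\<^esub> x = \<zero>\<^bsub>A\<^esub>"
        using x by (intro inj) (auto simp: simps B.M.l_neg)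
      then show "\<exists>y\<in>carrier A. y \<oplus>\<^bsub>A\<^esub> x = \<zero>\<^bsub>A\<^esub>"
        using y by blast
    qed (auto intro!: inj simp: simps B.M.a_ac)
  qed (auto intro!: inj simp: simps B.smult_l_distr B.smult_r_distr B.smult_assoc1)
  moreover have "f \<in> module_iso R A B"
    using bij f_add f_smult by (simp add: module_iso_def)
  ultimately show ?thesis
    using B by (auto simp: module_isomorphic_def)
qed

locale structure_sheaf_at_point = Module.module +
  fixes P
  assumes P: "P \<in> mSpec R M"
begin

sublocale at_P: module_localization R M "carrier R - colon R M P"
  by (rule module_localization_prime[OF P])

abbreviation X where "X \<equiv> zariski_topology R M"
abbreviation F where "F \<equiv> structure_sheaf R M"
abbreviation local_secs where "local_secs \<equiv> local_sections X F P"
abbreviation germ_P where "germ_P \<equiv> germ X F section_restrict P"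
abbreviation stalk_P where "stalk_P \<equiv> structure_sheaf_stalk R M P"
abbreviation M_P where "M_P \<equiv> localization_at R M (colon R M P)"

section \<open>Germs at P\<close>

lemma local_secs_iff: "(U, s) \<in> local_secs \<longleftrightarrow> openin X U \<and> P \<in> U \<and> s \<in> sections R M U"
  by (auto simp: local_sections_def structure_sheaf_def)

text \<open>Agreement near P gives agreement at P by evaluating, and \<open>sections_eq_near\<close>
  gives the converse. From here on, neighbourhoods disappear from all comparisons of germs.\<close>

lemma germ_rel_iff:
  "((U, s), (V, t)) \<in> germ_rel X F section_restrict P \<longleftrightarrow>
    (U, s) \<in> local_secs \<and> (V, t) \<in> local_secs \<and> s P = t P"
proof -
  have "s P = t P" if "restrict s W = restrict t W" "P \<in> W" for W
    using that by (metis restrict_apply')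
  moreover have "\<exists>W. openin X W \<and> P \<in> W \<and> W \<subseteq> U \<inter> V \<and> restrict s W = restrict t W"
    if "(U, s) \<in> local_secs" "(V, t) \<in> local_secs" "s P = t P"
  proof -
    have "s \<in> sections R M U" "P \<in> U" "t \<in> sections R M V" "P \<in> V"
      using that by (simp_all add: local_secs_iff)
    then show ?thesis
      using that(3) sections_eq_near by metis
  qed
  ultimately show ?thesis
    by (auto simp: germ_rel_def section_restrict_def)
qed

lemma in_germ_iff:
  "(U, s) \<in> local_secs \<Longrightarrow> (V, t) \<in> germ_P U s \<longleftrightarrow> (V, t) \<in> local_secs \<and> t P = s P"
  by (auto simp: germ_def germ_rel_iff)

text \<open>Since membership in a germ depends only on the value at P, the two classes have the same
  members; no separate proof that \<open>germ_rel\<close> is an equivalence is required.\<close>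

lemma germ_eqI:
  assumes "(U, s) \<in> local_secs" "(V, t) \<in> local_secs" "s P = t P"
  shows "germ_P U s = germ_P V t"
  using assms by (auto simp: in_germ_iff)

lemma germ_closed: "(U, s) \<in> local_secs \<Longrightarrow> germ_P U s \<in> carrier stalk_P"
  by (auto simp: structure_sheaf_stalk_def stalk_def germ_def intro: quotientI)

lemma stalk_cases:
  assumes "A \<in> carrier stalk_P"
  obtains U s where "(U, s) \<in> local_secs" "A = germ_P U s"
  using assms by (auto simp: structure_sheaf_stalk_def stalk_def germ_def elim!: quotientE)

lemma add_local_secs:
  assumes "(U, s) \<in> local_secs" "(V, t) \<in> local_secs"
  shows "(U \<inter> V, restrict s (U \<inter> V) \<oplus>\<^bsub>F (U \<inter> V)\<^esub> restrict t (U \<inter> V)) \<in> local_secs"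
  using assms by (auto simp: local_secs_iff intro!: add_sections restrict_sections)

lemma add_apply: "P \<in> U \<Longrightarrow> (s \<oplus>\<^bsub>F U\<^esub> t) P = s P \<oplus>\<^bsub>M_P\<^esub> t P"
  by (simp add: structure_sheaf_def)

lemma smult_local_secs:
  "\<lbrakk>(U, s) \<in> local_secs; a \<in> carrier R\<rbrakk> \<Longrightarrow> (U, a \<odot>\<^bsub>F U\<^esub> s) \<in> local_secs"
  by (auto simp: local_secs_iff intro!: smult_sections)

lemma smult_apply: "P \<in> U \<Longrightarrow> (a \<odot>\<^bsub>F U\<^esub> s) P = a \<odot>\<^bsub>M_P\<^esub> s P"
  by (simp add: structure_sheaf_def)

text \<open>Other representatives may live on other neighbourhoods, but the value of their sum at P
  depends only on the values of the summands at P. Hence all terms of the union in the definition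
  are the same germ.\<close>

lemma add_germ:
  assumes s: "(U, s) \<in> local_secs" and t: "(V, t) \<in> local_secs"
  shows "germ_P U s \<oplus>\<^bsub>stalk_P\<^esub> germ_P V t =
    germ_P (U \<inter> V) (restrict s (U \<inter> V) \<oplus>\<^bsub>F (U \<inter> V)\<^esub> restrict t (U \<inter> V))" (is "_ = ?r")
proof -
  let ?G = "\<lambda>U s V t. germ_P (U \<inter> V) (restrict s (U \<inter> V) \<oplus>\<^bsub>F (U \<inter> V)\<^esub> restrict t (U \<inter> V))"
  have "(U, s) \<in> germ_P U s" "(V, t) \<in> germ_P V t"
    using s t by (simp_all add: in_germ_iff)
  moreover have "?G U' s' V' t' = ?r"
    if "(U', s') \<in> germ_P U s" "(V', t') \<in> germ_P V t" for U' s' V' t'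
  proof -
    have *: "(U', s') \<in> local_secs" "s' P = s P" "(V', t') \<in> local_secs" "t' P = t P"
      using that s t by (simp_all add: in_germ_iff)
    then show ?thesis
      using s t by (intro germ_eqI add_local_secs) (simp_all add: add_apply local_secs_iff)
  qed
  ultimately have "(\<Union>(U', s')\<in>germ_P U s. \<Union>(V', t')\<in>germ_P V t. ?G U' s' V' t') = ?r"
    by fast
  then show ?thesis
    by (simp add: structure_sheaf_stalk_def stalk_def section_restrict_def)
qed

lemma smult_germ:
  assumes s: "(U, s) \<in> local_secs" and a: "a \<in> carrier R"
  shows "a \<odot>\<^bsub>stalk_P\<^esub> germ_P U s = germ_P U (a \<odot>\<^bsub>F U\<^esub> s)" (is "_ = ?r")
proof -
  have "(U, s) \<in> germ_P U s"
    using s by (simp add: in_germ_iff)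
  moreover have "germ_P U' (a \<odot>\<^bsub>F U'\<^esub> s') = ?r" if "(U', s') \<in> germ_P U s" for U' s'
  proof -
    have *: "(U', s') \<in> local_secs" "s' P = s P"
      using that s by (simp_all add: in_germ_iff)
    then show ?thesis
      using s a by (intro germ_eqI smult_local_secs) (simp_all add: smult_apply local_secs_iff)
  qed
  ultimately have "(\<Union>(U', s')\<in>germ_P U s. germ_P U' (a \<odot>\<^bsub>F U'\<^esub> s')) = ?r"
    by fast
  then show ?thesis
    by (simp add: structure_sheaf_stalk_def stalk_def)
qed

text \<open>
  Elements of \<open>M_P\<close> are sets of pairs, and all representatives of a germ take the same value
  at \<open>P\<close>, so the union below is that common value.
\<close>

definition germ_value where "germ_value A = (\<Union>(U, s)\<in>A. s P)"

lemma germ_value_germ: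
  assumes "(U, s) \<in> local_secs"
  shows "germ_value (germ_P U s) = s P"
proof -
  have "(U, s) \<in> germ_P U s" "\<And>V t. (V, t) \<in> germ_P U s \<Longrightarrow> t P = s P"
    using assms by (simp_all add: in_germ_iff)
  then show ?thesis
    unfolding germ_value_def by fast
qed

section \<open>Evaluation at P as an isomorphism\<close>

lemma bij_betw_germ_value: "bij_betw germ_value (carrier stalk_P) (carrier M_P)"
proof (rule bij_betwI')
  fix A B assume "A \<in> carrier stalk_P" "B \<in> carrier stalk_P"
  then show "germ_value A = germ_value B \<longleftrightarrow> A = B"
    by (metis stalk_cases germ_value_germ germ_eqI)
next
  fix A assume "A \<in> carrier stalk_P"
  then show "germ_value A \<in> carrier M_P"
    by (auto elim!: stalk_cases simp: germ_value_germ local_secs_iff intro: sections_closed)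
next
  fix Y assume "Y \<in> carrier M_P"
  then obtain m g where mg: "m \<in> carrier M" "g \<in> carrier R" "g \<notin> colon R M P"
    and Y: "Y = frac R M (carrier R - colon R M P) m g"
    by (auto simp: localization_at_def elim!: at_P.frac_cases)
  \<comment> \<open>This is the largest set of points where \<open>g\<close> is an admissible
    denominator, so a single fraction describes the section on all of it.\<close>
  define U where "U = {Q \<in> mSpec R M. g \<notin> colon R M Q}"
  define s where "s = (\<lambda>Q\<in>U. frac R M (carrier R - colon R M Q) m g)"
  have "P \<in> U"
    using P mg by (simp add: U_def)
  moreover have "openin X U"
    using openin_basic mg by (simp add: U_def)
  moreover from this have "s \<in> sections R M U"
    unfolding s_def using mg by (intro frac_sections) (simp_all add: U_def)
  ultimately have "(U, s) \<in> local_secs" "s P = Y"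
    by (simp_all add: local_secs_iff s_def Y)
  then show "\<exists>A\<in>carrier stalk_P. Y = germ_value A"
    using germ_closed germ_value_germ by metis
qed

lemma zero_local_secs: "(mSpec R M, \<zero>\<^bsub>F (mSpec R M)\<^esub>) \<in> local_secs"
  using P zero_sections openin_topspace[of X] by (simp add: local_secs_iff topspace_zariski)

lemma zero_stalk: "\<zero>\<^bsub>stalk_P\<^esub> = germ_P (mSpec R M) \<zero>\<^bsub>F (mSpec R M)\<^esub>"
  by (simp add: structure_sheaf_stalk_def stalk_def topspace_zariski)

lemma stalk_isomorphic: "module_isomorphic R stalk_P M_P"
proof (rule module_isomorphicI[OF _ bij_betw_germ_value])
  show "Module.module R M_P"
    using at_P.module_localization by (simp add: localization_at_def)
  show "\<zero>\<^bsub>stalk_P\<^esub> \<in> carrier stalk_P" "germ_value \<zero>\<^bsub>stalk_P\<^esub> = \<zero>\<^bsub>M_P\<^esub>"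
    using zero_local_secs P
    by (simp_all add: zero_stalk germ_closed germ_value_germ structure_sheaf_def)
next
  fix A B assume "A \<in> carrier stalk_P" "B \<in> carrier stalk_P"
  then obtain U s V t where A: "(U, s) \<in> local_secs" "A = germ_P U s"
    and B: "(V, t) \<in> local_secs" "B = germ_P V t"
    by (metis stalk_cases)
  then show "A \<oplus>\<^bsub>stalk_P\<^esub> B \<in> carrier stalk_P"
    by (simp add: add_germ germ_closed add_local_secs)
  \<comment> \<open>Restricted functions are \<open>undefined\<close> outside their domain, so
    evaluating the sum at P requires P to lie in the common domain.\<close>
  from A B have "P \<in> U \<inter> V"
    by (simp add: local_secs_iff)
  with A B show "germ_value (A \<oplus>\<^bsub>stalk_P\<^esub> B) = germ_value A \<oplus>\<^bsub>M_P\<^esub> germ_value B"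
    by (simp add: add_germ germ_value_germ add_local_secs add_apply)
next
  fix a A assume a: "a \<in> carrier R" and "A \<in> carrier stalk_P"
  then obtain U s where A: "(U, s) \<in> local_secs" "A = germ_P U s"
    by (metis stalk_cases)
  with a show "a \<odot>\<^bsub>stalk_P\<^esub> A \<in> carrier stalk_P"
    by (simp add: smult_germ germ_closed smult_local_secs)
  from A have "P \<in> U"
    by (simp add: local_secs_iff)
  with A a show "germ_value (a \<odot>\<^bsub>stalk_P\<^esub> A) = a \<odot>\<^bsub>M_P\<^esub> germ_value A"
    by (simp add: smult_germ germ_value_germ smult_local_secs smult_apply)
qed

end

theorem theorem3p1:
  fixes R :: "('a, 'r) ring_scheme" and M :: "('a, 'b, 'm) module_scheme" and P :: "'b set"
  assumes "cring R" and "\<one>\<^bsub>R\<^esub> \<noteq> \<zero>\<^bsub>R\<^esub>" and "Module.module R M"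
    and "P \<in> mSpec R M"
  shows "module_isomorphic R (structure_sheaf_stalk R M P) (localization_at R M (colon R M P))"
proof -
  interpret structure_sheaf_at_point R M P
    using assms by (simp add: structure_sheaf_at_point_def structure_sheaf_at_point_axioms_def)
  show ?thesis
    by (rule stalk_isomorphic)
qed

end
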